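(* Let $\ell, m, u, v$ be positive integers with $u \leq m$, and let $K$ be a set of integers, each at least $2$, with $\ell \in K$. Suppose there exist a TD$(\ell+1,m)$, a TD$(\ell,u)$, a $K$-GDD of type $u^{\ell} v^1$, and an $(mu+1,K)$-PBD. Then for every integer $t$ with $0 \leq t \leq m-u$ there exists a $K$-GDD of type $\ell^{mu}(tv+1)^1$.
   Context: For a set $K$ of positive integers (each at least $2$), a $K$-GDD (group-divisible design) is a triple $(X,\mathcal{G},\mathcal{A})$ where $X$ is a finite set of points, $\mathcal{G}$ is a partition of $X$ into groups, and $\mathcal{A}$ is a collection of subsets (blocks) of $X$ such that every block meets every group in at most one point, every pair of points from different groups lies in exactly one block, and every block has size in $K$. If $K=\{k\}$ we write $k$-GDD. The type of the GDD is the multiset of group sizes, written exponentially: type $t_1^{u_1} t_2^{u_2}\cdots$ means $u_i$ groups of size $t_i$. A TD$(k,n)$ (transversal design) is a $k$-GDD of type $n^k$. A $(w,K)$-PBD (pairwise balanced design) is a pair $(X,\mathcal{A})$ with $|X|=w$ and $\mathcal{A}$ a collection of subsets (blocks) of $X$ such that every pair of distinct points lies in exactly one block and every block has size in $K$. *)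

theory Defs
  imports Main "HOL-Library.Multiset" "HOL-Library.Disjoint_Sets"
begin

definition is_GDD :: "nat set \<Rightarrow> 'a set \<Rightarrow> 'a set set \<Rightarrow> 'a set set \<Rightarrow> bool" where
  "is_GDD K X G A \<longleftrightarrow>
     finite X \<and> partition_on X G \<and> (\<forall>B\<in>A. B \<subseteq> X) \<and>
     (\<forall>B\<in>A. \<forall>g\<in>G. card (B \<inter> g) \<le> 1) \<and>
     (\<forall>g\<in>G. \<forall>h\<in>G. g \<noteq> h \<longrightarrow> (\<forall>x\<in>g. \<forall>y\<in>h. \<exists>!B. B \<in> A \<and> x \<in> B \<and> y \<in> B)) \<and>
     (\<forall>B\<in>A. card B \<in> K)"

definition group_type :: "'a set set \<Rightarrow> nat multiset" where
  "group_type G = image_mset card (mset_set G)"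

definition is_PBD :: "nat \<Rightarrow> nat set \<Rightarrow> 'a set \<Rightarrow> 'a set set \<Rightarrow> bool" where
  "is_PBD w K X A \<longleftrightarrow>
     finite X \<and> card X = w \<and> (\<forall>B\<in>A. B \<subseteq> X) \<and>
     (\<forall>x\<in>X. \<forall>y\<in>X. x \<noteq> y \<longrightarrow> (\<exists>!B. B \<in> A \<and> x \<in> B \<and> y \<in> B)) \<and>
     (\<forall>B\<in>A. card B \<in> K)"

text \<open>Existence is stated over point sets of natural numbers. Since point sets are finite, this
  is no restriction: see \<open>GDD_existsI\<close> and \<open>PBD_existsI\<close> below. The type
  $t_1^{u_1} t_2^{u_2} \cdots$ is the multiset
  \<open>replicate_mset u1 t1 + replicate_mset u2 t2 + \<dots>\<close> (multiplicity first).\<close>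

definition GDD_exists :: "nat set \<Rightarrow> nat multiset \<Rightarrow> bool" where
  "GDD_exists K T \<longleftrightarrow> (\<exists>(X :: nat set) G A. is_GDD K X G A \<and> group_type G = T)"

definition TD_exists :: "nat \<Rightarrow> nat \<Rightarrow> bool" where
  "TD_exists k n \<longleftrightarrow> GDD_exists {k} (replicate_mset k n)"

definition PBD_exists :: "nat \<Rightarrow> nat set \<Rightarrow> bool" where
  "PBD_exists w K \<longleftrightarrow> (\<exists>(X :: nat set) A. is_PBD w K X A)"

lemma ex1_image_block:
  assumes inj: "inj_on f X" and sub: "\<forall>B\<in>A. B \<subseteq> X" and "x \<in> X" "y \<in> X"
    and ex1: "\<exists>!B. B \<in> A \<and> x \<in> B \<and> y \<in> B"
  shows "\<exists>!B. B \<in> (`) f ` A \<and> f x \<in> B \<and> f y \<in> B"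
proof -
  have mem: "f z \<in> f ` B \<longleftrightarrow> z \<in> B" if "B \<in> A" "z \<in> X" for B z
    by (rule inj_on_image_mem_iff[OF inj that(2)]) (use sub that(1) in blast)
  from ex1 obtain B where B: "B \<in> A \<and> x \<in> B \<and> y \<in> B"
    and uniq: "\<forall>C. C \<in> A \<and> x \<in> C \<and> y \<in> C \<longrightarrow> C = B" by (rule ex1E)
  show ?thesis
  proof (rule ex1I[of _ "f ` B"])
    show "f ` B \<in> (`) f ` A \<and> f x \<in> f ` B \<and> f y \<in> f ` B" using B by blast
  next
    fix C assume C: "C \<in> (`) f ` A \<and> f x \<in> C \<and> f y \<in> C"
    then obtain D where D: "D \<in> A" "C = f ` D" by blast
    then have "x \<in> D" "y \<in> D" using C mem assms(3,4) by auto
    then show "C = f ` B" using uniq D by simp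
  qed
qed

lemma is_GDD_image:
  assumes inj: "inj_on f X" and gdd: "is_GDD K X G A"
  shows "is_GDD K (f ` X) ((`) f ` G) ((`) f ` A)"
    and "group_type ((`) f ` G) = group_type G"
proof -
  from gdd have fin: "finite X" and part: "partition_on X G" and sub: "\<forall>B\<in>A. B \<subseteq> X"
    and meet: "\<forall>B\<in>A. \<forall>g\<in>G. card (B \<inter> g) \<le> 1"
    and pair: "\<forall>g\<in>G. \<forall>h\<in>G. g \<noteq> h \<longrightarrow> (\<forall>x\<in>g. \<forall>y\<in>h. \<exists>!B. B \<in> A \<and> x \<in> B \<and> y \<in> B)"
    and size: "\<forall>B\<in>A. card B \<in> K"
    unfolding is_GDD_def by auto
  have gsub: "g \<subseteq> X" if "g \<in> G" for g
    using part that unfolding partition_on_def by blast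
  have cardim: "card (f ` S) = card S" if "S \<subseteq> X" for S
    using card_image[OF inj_on_subset[OF inj that]] .
  have injG: "inj_on ((`) f) G"
    using inj gsub by (intro inj_onI) (simp add: inj_on_image_eq_iff)
  have part': "partition_on (f ` X) ((`) f ` G)"
  proof -
    have "(`) f ` G - {{}} = (`) f ` G"
      using part unfolding partition_on_def by auto
    then show ?thesis using partition_on_inj_image[OF part inj] by simp
  qed
  have meet': "card (f ` B \<inter> f ` g) \<le> 1" if "B \<in> A" "g \<in> G" for B g
  proof -
    have "f ` B \<inter> f ` g = f ` (B \<inter> g)"
      using inj_on_image_Int[OF inj, of B g] sub gsub that by simp
    moreover have "B \<inter> g \<subseteq> X" using gsub that by blast
    ultimately show ?thesis using meet that cardim by simp
  qed
  have pair': "\<exists>!B. B \<in> (`) f ` A \<and> f x \<in> B \<and> f y \<in> B"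
    if "g \<in> G" "h \<in> G" "f ` g \<noteq> f ` h" "x \<in> g" "y \<in> h" for g h x y
  proof (rule ex1_image_block[OF inj sub])
    show "x \<in> X" "y \<in> X" using gsub that by auto
    have "g \<noteq> h" using that by blast
    then show "\<exists>!B. B \<in> A \<and> x \<in> B \<and> y \<in> B"
      using that by (intro pair[rule_format])
  qed
  have sub': "\<forall>B\<in>(`) f ` A. B \<subseteq> f ` X" using sub by blast
  have meet'': "\<forall>B\<in>(`) f ` A. \<forall>g\<in>(`) f ` G. card (B \<inter> g) \<le> 1"
    using meet' by simp
  have pair'': "\<forall>g\<in>(`) f ` G. \<forall>h\<in>(`) f ` G. g \<noteq> h \<longrightarrow>
      (\<forall>x\<in>g. \<forall>y\<in>h. \<exists>!B. B \<in> (`) f ` A \<and> x \<in> B \<and> y \<in> B)"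
  proof (intro ballI impI)
    fix g' h' x' y'
    assume g': "g' \<in> (`) f ` G" and h': "h' \<in> (`) f ` G" and ne: "g' \<noteq> h'"
      and x': "x' \<in> g'" and y': "y' \<in> h'"
    from g' h' obtain g h where gh: "g \<in> G" "h \<in> G" "g' = f ` g" "h' = f ` h" by blast
    with x' y' obtain x y where xy: "x \<in> g" "y \<in> h" "x' = f x" "y' = f y" by blast
    show "\<exists>!B. B \<in> (`) f ` A \<and> x' \<in> B \<and> y' \<in> B"
      unfolding xy using gh xy ne by (intro pair') auto
  qed
  have size': "\<forall>B\<in>(`) f ` A. card B \<in> K" using size cardim sub by simp
  show "is_GDD K (f ` X) ((`) f ` G) ((`) f ` A)"
    unfolding is_GDD_def
    by (intro conjI finite_imageI fin part' sub' meet'' pair'' size')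
  have "image_mset card (mset_set ((`) f ` G)) = image_mset (\<lambda>g. card (f ` g)) (mset_set G)"
    using image_mset_mset_set[OF injG, symmetric] by (simp add: multiset.map_comp comp_def)
  also have "\<dots> = image_mset card (mset_set G)"
  proof (rule image_mset_cong)
    fix g assume "g \<in># mset_set G"
    then have "g \<in> G" by (cases "finite G") auto
    then show "card (f ` g) = card g" using cardim gsub by blast
  qed
  finally show "group_type ((`) f ` G) = group_type G" unfolding group_type_def .
qed

lemma GDD_existsI:
  assumes "is_GDD K X G A"
  shows "GDD_exists K (group_type G)"
proof -
  have "finite X" using assms unfolding is_GDD_def by blast
  then obtain f :: "_ \<Rightarrow> nat" where "inj_on f X" using finite_imp_inj_to_nat_seg by blast
  note image = is_GDD_image[OF this assms]
  show ?thesis unfolding GDD_exists_def by (intro exI conjI) (rule image)+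
qed

lemma PBD_existsI:
  assumes "is_PBD w K X A"
  shows "PBD_exists w K"
proof -
  have pbd: "finite X" "card X = w" and sub: "\<forall>B\<in>A. B \<subseteq> X"
    and pair: "\<forall>x\<in>X. \<forall>y\<in>X. x \<noteq> y \<longrightarrow> (\<exists>!B. B \<in> A \<and> x \<in> B \<and> y \<in> B)"
    and size: "\<forall>B\<in>A. card B \<in> K"
    using assms unfolding is_PBD_def by auto
  obtain f :: "_ \<Rightarrow> nat" where inj: "inj_on f X"
    using pbd(1) finite_imp_inj_to_nat_seg by blast
  have pair': "\<forall>x\<in>f ` X. \<forall>y\<in>f ` X. x \<noteq> y \<longrightarrow> (\<exists>!B. B \<in> (`) f ` A \<and> x \<in> B \<and> y \<in> B)"
  proof (intro ballI impI)
    fix x' y' assume "x' \<in> f ` X" "y' \<in> f ` X" and ne: "x' \<noteq> y'"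
    then obtain x y where xy: "x \<in> X" "y \<in> X" "x' = f x" "y' = f y" by blast
    have "x \<noteq> y" using xy ne by blast
    then have "\<exists>!B. B \<in> A \<and> x \<in> B \<and> y \<in> B" using xy by (intro pair[rule_format])
    then show "\<exists>!B. B \<in> (`) f ` A \<and> x' \<in> B \<and> y' \<in> B"
      unfolding xy(3,4) by (rule ex1_image_block[OF inj sub xy(1,2)])
  qed
  have size': "\<forall>B\<in>(`) f ` A. card B \<in> K"
  proof
    fix C assume "C \<in> (`) f ` A"
    then obtain B where B: "B \<in> A" "C = f ` B" by blast
    then have "card C = card B" using card_image[OF inj_on_subset[OF inj]] sub by blast
    then show "card C \<in> K" using size B by simp
  qed
  have "is_PBD w K (f ` X) ((`) f ` A)"
    unfolding is_PBD_def using pbd card_image[OF inj] sub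
    by (intro conjI finite_imageI pair' size') auto
  then show ?thesis unfolding PBD_exists_def by blast
qed

end

theory Submission imports Defs begin

text \<open>
  Delete a group \<open>H\<close> of the TD\<open>(l+1,m)\<close>: each point of \<open>H\<close> becomes a parallel class of
  the remaining TD\<open>(l,m)\<close>. Give weight \<open>u\<close> to all points outside \<open>H\<close>, weight \<open>v\<close> to \<open>t\<close> points of
  \<open>H\<close>, weight \<open>0\<close> to the others, and apply Wilson's fundamental construction. Adjoin a point at
  infinity and fill each inflated group other than \<open>H\<close> with the PBD; this is a GDD whose only
  nontrivial group has size \<open>tv+1\<close>. Since \<open>m - t \<ge> u\<close>, there are distinct points
  \<open>c 0, \<dots>, c (u-1)\<close> of weight \<open>0\<close> in \<open>H\<close>. The TD\<open>(l,u)\<close> placed on a block \<open>B\<close> through \<open>c i\<close> can be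
  relabelled so that the \<open>i\<close>-th layer \<open>(B - H) \<times> {i}\<close> is one of its blocks; these layers partition
  the points outside the large group, and they become the groups of size \<open>l\<close>.
\<close>

section \<open>Elementary facts on GDDs, transversal blocks and group types\<close>

text \<open>Blocks are subsets of a finite set, so a cardinality bound of 1 on an intersection says
  exactly that any two of its points coincide. This pointwise form is the one verified whenever a
  new GDD is built.\<close>

lemma is_GDD_iff:
  "is_GDD K X G A \<longleftrightarrow> finite X \<and> partition_on X G \<and>
     (\<forall>B\<in>A. B \<subseteq> X \<and> card B \<in> K \<and> (\<forall>g\<in>G. \<forall>x\<in>B \<inter> g. \<forall>y\<in>B \<inter> g. x = y)) \<and>
     (\<forall>g\<in>G. \<forall>h\<in>G. g \<noteq> h \<longrightarrow> (\<forall>x\<in>g. \<forall>y\<in>h. \<exists>!B. B \<in> A \<and> x \<in> B \<and> y \<in> B))"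
proof -
  have eq: "(\<forall>B\<in>A. \<forall>g\<in>G. card (B \<inter> g) \<le> 1) \<longleftrightarrow>
      (\<forall>B\<in>A. \<forall>g\<in>G. \<forall>x\<in>B \<inter> g. \<forall>y\<in>B \<inter> g. x = y)"
    if fin: "finite X" and sub: "\<forall>B\<in>A. B \<subseteq> X"
  proof (intro ball_cong refl)
    fix B g assume "B \<in> A"
    then have "finite (B \<inter> g)" using finite_subset[OF _ fin] sub by blast
    then show "card (B \<inter> g) \<le> 1 \<longleftrightarrow> (\<forall>x\<in>B \<inter> g. \<forall>y\<in>B \<inter> g. x = y)"
      using card_le_Suc0_iff_eq[of "B \<inter> g"] by simp
  qed
  \<comment> \<open>The equivalence of the two intersection conditions holds only under finiteness
    of \<open>X\<close> and containment of the blocks, so the rearrangement takes it as a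
    conditional equivalence.\<close>
  have shuffle: "(a \<and> b \<and> c \<and> d \<and> e \<and> f) \<longleftrightarrow> (a \<and> b \<and> (c \<and> f \<and> d') \<and> e)"
    if "a \<Longrightarrow> c \<Longrightarrow> d \<longleftrightarrow> d'" for a b c d d' e f
    using that by blast
  show ?thesis unfolding is_GDD_def ball_conj_distrib by (rule shuffle[OF eq])
qed

lemma is_GDD_D:
  assumes "is_GDD K X G A"
  shows "finite X" "partition_on X G" "B \<in> A \<Longrightarrow> B \<subseteq> X" "B \<in> A \<Longrightarrow> card B \<in> K"
    "B \<in> A \<Longrightarrow> g \<in> G \<Longrightarrow> card (B \<inter> g) \<le> 1"
  using assms unfolding is_GDD_def by simp_all

lemma is_GDD_mono: "is_GDD K X G A \<Longrightarrow> K \<subseteq> L \<Longrightarrow> is_GDD L X G A"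
  unfolding is_GDD_def
  by (elim conjE, intro conjI) (assumption | rule ballI, erule subsetD, erule (1) bspec)+

lemma is_GDD_same_group:
  assumes "is_GDD K X G A" "B \<in> A" "g \<in> G" "x \<in> B" "x \<in> g" "y \<in> B" "y \<in> g"
  shows "x = y"
  using assms unfolding is_GDD_iff by blast

lemma is_GDD_pair:
  assumes "is_GDD K X G A" "g \<in> G" "h \<in> G" "g \<noteq> h" "x \<in> g" "y \<in> h"
  shows "\<exists>!B. B \<in> A \<and> x \<in> B \<and> y \<in> B"
proof -
  from assms(1) have "\<forall>g\<in>G. \<forall>h\<in>G. g \<noteq> h \<longrightarrow> (\<forall>x\<in>g. \<forall>y\<in>h. \<exists>!B. B \<in> A \<and> x \<in> B \<and> y \<in> B)"
    unfolding is_GDD_def by (elim conjE)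
  from this[rule_format, OF assms(2-)] show ?thesis .
qed

lemma partition_on_unique:
  assumes "partition_on X G" "g \<in> G" "h \<in> G" "x \<in> g" "x \<in> h"
  shows "g = h"
  using assms unfolding partition_on_def disjoint_def by blast

text \<open>Two distinct points of a common block lie in different groups, so the pair condition
  applies to them even when their groups are not mentioned.\<close>

lemma is_GDD_block_unique:
  assumes gdd: "is_GDD K X G A" and "B \<in> A" "C \<in> A" "x \<in> B" "y \<in> B" "x \<in> C" "y \<in> C" "x \<noteq> y"
  shows "B = C"
proof -
  have "x \<in> X" "y \<in> X" "partition_on X G" using is_GDD_D[OF gdd] assms(2,4,5) by blast+
  then obtain g h where gh: "g \<in> G" "h \<in> G" "x \<in> g" "y \<in> h"
    unfolding partition_on_def by blast
  have "g \<noteq> h" using is_GDD_same_group[OF gdd assms(2)] gh assms by blast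
  from is_GDD_pair[OF gdd gh(1,2) this gh(3,4)] show ?thesis using assms by blast
qed

lemma group_type_replicate:
  assumes "finite G" "group_type G = replicate_mset k n"
  shows "card G = k" "\<And>g. g \<in> G \<Longrightarrow> card g = n"
proof -
  have "size (group_type G) = card G" unfolding group_type_def by simp
  with assms(2) show "card G = k" by simp
  show "card g = n" if "g \<in> G" for g
  proof -
    have "card g \<in># group_type G" unfolding group_type_def using that assms(1) by simp
    then show ?thesis unfolding assms(2) by (simp split: if_splits)
  qed
qed

text \<open>An infinite \<open>G\<close> is covered as well: \<open>mset_set\<close> and
  \<open>card\<close> then give the empty multiset and 0.\<close>

lemma group_type_constant:
  assumes "\<And>g. g \<in> G \<Longrightarrow> card g = n"
  shows "group_type G = replicate_mset (card G) n"
proof -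
  have "image_mset card (mset_set G) = image_mset (\<lambda>_. n) (mset_set G)"
    using assms by (intro image_mset_cong) (cases "finite G"; simp)
  then show ?thesis unfolding group_type_def by (simp add: image_mset_const_eq)
qed

lemma group_type_insert:
  "finite G \<Longrightarrow> S \<notin> G \<Longrightarrow> group_type (insert S G) = group_type G + replicate_mset 1 (card S)"
  unfolding group_type_def by simp

text \<open>The groups cut \<open>B\<close> into \<open>card G\<close> pieces of size at most 1, and
  the sizes sum to \<open>card B = card G\<close>, so every piece has size exactly 1.\<close>

lemma transversal_block:
  assumes gdd: "is_GDD {card G} X G A" and "B \<in> A" "g \<in> G"
  obtains x where "B \<inter> g = {x}"
proof -
  have fX: "finite X" and part: "partition_on X G" and BX: "B \<subseteq> X" and cB: "card B = card G"
    using is_GDD_D[OF gdd] assms(2) by auto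
  have le: "card (B \<inter> h) \<le> 1" if "h \<in> G" for h
    using is_GDD_D(5)[OF gdd assms(2) that] .
  have fG: "finite G" using finite_elements[OF fX part] .
  have fB: "finite B" using finite_subset[OF BX fX] .
  have eq: "B = (\<Union>h\<in>G. B \<inter> h)" using BX partition_onD1[OF part] by blast
  have "card (\<Union>h\<in>G. B \<inter> h) = (\<Sum>h\<in>G. card (B \<inter> h))"
    by (rule card_UN_disjoint) (use fG fB in simp, use fB in simp, use partition_on_unique[OF part] in blast)
  with arg_cong[OF eq, of card] have "card B = (\<Sum>h\<in>G. card (B \<inter> h))" by (rule trans)
  with cB have sum: "(\<Sum>h\<in>G. card (B \<inter> h)) = (\<Sum>h\<in>G. 1)" by simp
  have "card (B \<inter> g) = 1"
  proof (rule ccontr)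
    assume "card (B \<inter> g) \<noteq> 1"
    with le[OF assms(3)] have "card (B \<inter> g) < 1" by linarith
    then have "(\<Sum>h\<in>G. card (B \<inter> h)) < (\<Sum>h\<in>G. 1)"
      by (intro sum_strict_mono_ex1) (use fG le assms(3) in auto)
    with sum show False by simp
  qed
  then show ?thesis using that by (auto simp: card_1_singleton_iff)
qed

subsection \<open>Transport along bijections of the groups\<close>

text \<open>Equal types mean equally many groups of each size \<open>n\<close>. Bijections between
  the size classes, one for each \<open>n\<close>, glue to a bijection of all groups.\<close>

lemma group_type_eq_bij:
  assumes fin: "finite G" "finite Q" and eq: "group_type G = group_type Q"
  obtains f where "bij_betw f G Q" "\<And>g. g \<in> G \<Longrightarrow> card (f g) = card g"
proof -
  have cnt: "count (group_type P) n = card {p \<in> P. card p = n}" if "finite P" for P :: "'c set set" and n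
    using that unfolding group_type_def count_image_mset
    by (auto simp: vimage_def count_mset_set Int_def conj_commute)
  have "\<exists>b. bij_betw b {g \<in> G. card g = n} {q \<in> Q. card q = n}" for n
    using fin by (intro finite_same_card_bij) (simp_all flip: cnt add: eq)
  then obtain b where b: "\<And>n. bij_betw (b n) {g \<in> G. card g = n} {q \<in> Q. card q = n}"
    by metis
  let ?f = "\<lambda>g. b (card g) g"
  have im: "?f g \<in> Q \<and> card (?f g) = card g" if "g \<in> G" for g
    using bij_betwE[OF b[of "card g"]] that by blast
  have "inj_on ?f G"
  proof (rule inj_onI)
    fix g h assume gh: "g \<in> G" "h \<in> G" "?f g = ?f h"
    then have "card g = card h" using im by metis
    with gh show "g = h"
      using inj_onD[OF bij_betw_imp_inj_on[OF b[of "card g"]], of g h] by simp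
  qed
  moreover have "Q \<subseteq> ?f ` G"
  proof
    fix q assume "q \<in> Q"
    then have "q \<in> b (card q) ` {g \<in> G. card g = card q}"
      using bij_betw_imp_surj_on[OF b[of "card q"]] by blast
    then show "q \<in> ?f ` G" by force
  qed
  ultimately have "bij_betw ?f G Q" using im unfolding bij_betw_def by blast
  then show ?thesis using that im by blast
qed

lemma finite_same_card_bij_point:
  assumes "finite A" "finite B" "card A = card B" "a \<in> A" "b \<in> B"
  shows "\<exists>h. bij_betw h A B \<and> h a = b"
proof -
  have "card (A - {a}) = card (B - {b})" using assms by simp
  then obtain h where h: "bij_betw h (A - {a}) (B - {b})"
    using finite_same_card_bij assms by (metis finite_Diff)
  have "bij_betw (h(a := b)) (A - {a}) (B - {b})"
    using h by (subst bij_betw_cong[where g = h]) auto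
  then have "bij_betw (h(a := b)) ((A - {a}) \<union> {a}) ((B - {b}) \<union> {b})"
    by (intro bij_betw_combine) (auto simp: bij_betw_def)
  then show ?thesis using assms by (intro exI[of _ "h(a := b)"]) (simp add: insert_absorb)
qed

text \<open>Match the groups by size, then choose the bijection inside each group freely. This
  freedom allows the marked point of each group to go to a prescribed point, which is how a chosen
  transversal is carried onto a given one.\<close>

lemma partition_bij:
  assumes fin: "finite X" "finite Y" and part: "partition_on X G" "partition_on Y Q"
    and eq: "group_type G = group_type Q"
    and a: "\<And>g. g \<in> G \<Longrightarrow> a g \<in> g" and b: "\<And>q. q \<in> Q \<Longrightarrow> b q \<in> q"
  obtains f where "inj_on f X" "f ` X = Y" "(`) f ` G = Q" "f ` a ` G = b ` Q"
proof -
  have fG: "finite G" "finite Q" using finite_elements fin part by auto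
  obtain \<phi> where \<phi>: "bij_betw \<phi> G Q" "\<And>g. g \<in> G \<Longrightarrow> card (\<phi> g) = card g"
    using group_type_eq_bij[OF fG eq] by blast
  have \<phi>Q: "\<phi> g \<in> Q" if "g \<in> G" for g using \<phi>(1) that by (rule bij_betw_apply)
  have sub: "\<And>g. g \<in> G \<Longrightarrow> g \<subseteq> X" "\<And>q. q \<in> Q \<Longrightarrow> q \<subseteq> Y"
    using part unfolding partition_on_def by auto
  have "\<exists>h. bij_betw h g (\<phi> g) \<and> h (a g) = b (\<phi> g)" if g: "g \<in> G" for g
    using finite_subset[OF sub(1)[OF g] fin(1)] finite_subset[OF sub(2)[OF \<phi>Q[OF g]] fin(2)]
      \<phi>(2)[OF g, symmetric] a[OF g] b[OF \<phi>Q[OF g]]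
    by (rule finite_same_card_bij_point)
  then obtain h where h: "\<And>g. g \<in> G \<Longrightarrow> bij_betw (h g) g (\<phi> g)"
    "\<And>g. g \<in> G \<Longrightarrow> h g (a g) = b (\<phi> g)" by metis
  \<comment> \<open>The bijections of the single groups are glued; the description picks the unique
    group that contains \<open>x\<close>.\<close>
  define f where "f x = h (THE g. g \<in> G \<and> x \<in> g) x" for x
  have fx: "f x = h g x" if "g \<in> G" "x \<in> g" for g x
  proof -
    have "(THE g. g \<in> G \<and> x \<in> g) = g"
      using that partition_on_unique[OF part(1)] by (intro the_equality) auto
    then show ?thesis unfolding f_def by simp
  qed
  have img: "f ` g = \<phi> g" if "g \<in> G" for g
  proof -
    have "f ` g = h g ` g" using fx that by (intro image_cong) auto
    then show ?thesis using bij_betw_imp_surj_on[OF h(1)[OF that]] by simp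
  qed
  have X: "X = \<Union>G" and Y: "Y = \<Union>Q" using part unfolding partition_on_def by auto
  have \<phi>G: "\<phi> ` G = Q" using \<phi>(1) by (rule bij_betw_imp_surj_on)
  have imG: "(`) f ` G = Q" using img \<phi>G by (metis image_cong)
  have "f ` X = Y" unfolding X Y using imG by (metis image_Union)
  moreover have "inj_on f X"
  proof (rule inj_onI)
    fix x y assume xy: "x \<in> X" "y \<in> X" "f x = f y"
    then obtain g k where gk: "g \<in> G" "k \<in> G" "x \<in> g" "y \<in> k" unfolding X by blast
    have "f x \<in> \<phi> g" "f x \<in> \<phi> k" using gk img xy(3) by (metis imageI)+
    then have "\<phi> g = \<phi> k" using partition_on_unique[OF part(2)] \<phi>Q gk by blast
    then have "g = k" using \<phi>(1) gk by (metis bij_betw_def inj_onD)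
    then show "x = y"
      using gk xy(3) fx h(1) by (metis bij_betw_def inj_onD)
  qed
  moreover have "f ` a ` G = b ` Q"
  proof -
    have "f (a g) = b (\<phi> g)" if "g \<in> G" for g using that fx a h(2) by simp
    then have "f ` a ` G = b ` \<phi> ` G" unfolding image_image by (intro image_cong) auto
    then show ?thesis unfolding \<phi>G .
  qed
  ultimately show ?thesis using that imG by blast
qed

lemma GDD_on_partition:
  assumes ex: "GDD_exists K (group_type Q)" and Y: "finite Y" "partition_on Y Q"
  obtains D where "is_GDD K Y Q D"
proof -
  obtain X :: "nat set" and G A where gdd: "is_GDD K X G A" and eq: "group_type G = group_type Q"
    using ex unfolding GDD_exists_def by blast
  have X: "finite X" "partition_on X G" using is_GDD_D[OF gdd] by auto
  \<comment> \<open>\<open>partition_bij\<close> asks for marked points; arbitrary ones suffice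
    here.\<close>
  have some: "(SOME x. x \<in> p) \<in> p" if "{} \<notin> P" "p \<in> P" for P :: "'c set set" and p
    using that by (metis ex_in_conv someI_ex)
  have a: "(SOME x. x \<in> g) \<in> g" if "g \<in> G" for g by (rule some[OF partition_onD3[OF X(2)] that])
  have b: "(SOME y. y \<in> q) \<in> q" if "q \<in> Q" for q by (rule some[OF partition_onD3[OF Y(2)] that])
  obtain f where f: "inj_on f X" "f ` X = Y" "(`) f ` G = Q"
    using partition_bij[OF X(1) Y(1) X(2) Y(2) eq a b] by blast
  show ?thesis using that is_GDD_image(1)[OF f(1) gdd] f(2,3) by simp
qed

lemma TD_on_partition:
  assumes ex: "TD_exists k n" and Y: "finite Y" "partition_on Y Q" and "k \<ge> 2"
    and type: "group_type Q = replicate_mset k n" and b: "\<And>q. q \<in> Q \<Longrightarrow> b q \<in> q"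
  obtains D where "is_GDD {k} Y Q D" "b ` Q \<in> D"
proof -
  obtain X :: "nat set" and G A where gdd: "is_GDD {k} X G A" and eq: "group_type G = replicate_mset k n"
    using ex unfolding TD_exists_def GDD_exists_def by blast
  have X: "finite X" "partition_on X G" using is_GDD_D[OF gdd] by auto
  have cG: "card G = k" using group_type_replicate(1)[OF finite_elements[OF X] eq] .
  \<comment> \<open>Two different groups exist because \<open>k \<ge> 2\<close>; the pair condition
    for a point from each yields a block to start from.\<close>
  obtain g h where gh: "g \<in> G" "h \<in> G" "g \<noteq> h"
    using \<open>k \<ge> 2\<close> cG by (metis card_2_iff' obtain_subset_with_card_n subsetD)
  obtain x y where "x \<in> g" "y \<in> h" using gh partition_onD3[OF X(2)] by (metis ex_in_conv)
  with is_GDD_pair[OF gdd gh] obtain B where B: "B \<in> A" by blast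
  have "\<exists>x. B \<inter> g = {x}" if "g \<in> G" for g
    using transversal_block[of G X A B g] gdd cG B that by metis
  then obtain a where a: "\<And>g. g \<in> G \<Longrightarrow> B \<inter> g = {a g}" by metis
  have "B \<subseteq> X" using is_GDD_D(3)[OF gdd B] .
  then have aB: "a ` G = B" using a X(2) unfolding partition_on_def by blast
  have "a g \<in> g" if "g \<in> G" for g using a[OF that] by blast
  then obtain f where f: "inj_on f X" "f ` X = Y" "(`) f ` G = Q" "f ` a ` G = b ` Q"
    using partition_bij[OF X(1) Y(1) X(2) Y(2), of a b] eq type b by metis
  show ?thesis
  proof (rule that)
    show "is_GDD {k} Y Q ((`) f ` A)" using is_GDD_image(1)[OF f(1) gdd] f(2,3) by simp
    show "b ` Q \<in> (`) f ` A" using f(4) aB B by blast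
  qed
qed

lemma PBD_on_set:
  assumes ex: "PBD_exists w K" and Y: "finite Y" "card Y = w"
  obtains D where "is_PBD w K Y D"
proof -
  obtain X :: "nat set" and A where pbd: "is_PBD w K X A" using ex unfolding PBD_exists_def by blast
  then have X: "finite X" "card X = w" and sub: "\<forall>B\<in>A. B \<subseteq> X" and size: "\<forall>B\<in>A. card B \<in> K"
    and pair: "\<And>x y. x \<in> X \<Longrightarrow> y \<in> X \<Longrightarrow> x \<noteq> y \<Longrightarrow> \<exists>!B. B \<in> A \<and> x \<in> B \<and> y \<in> B"
    unfolding is_PBD_def by simp_all
  obtain f where f: "inj_on f X" "f ` X = Y"
    using finite_same_card_bij[of X Y] X Y unfolding bij_betw_def by auto
  have pair': "\<exists>!B. B \<in> (`) f ` A \<and> x \<in> B \<and> y \<in> B" if xy: "x \<in> Y" "y \<in> Y" "x \<noteq> y" for x y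
  proof -
    obtain x' y' where x': "x' \<in> X" "x = f x'" and y': "y' \<in> X" "y = f y'" using xy f by blast
    then have "x' \<noteq> y'" using xy(3) by blast
    then show ?thesis unfolding x'(2) y'(2)
      by (intro ex1_image_block[OF f(1) sub x'(1) y'(1)] pair x'(1) y'(1))
  qed
  have size': "card (f ` B) \<in> K" if "B \<in> A" for B
    using that size sub card_image[OF inj_on_subset[OF f(1)], of B] by simp
  have "is_PBD w K Y ((`) f ` A)"
    unfolding is_PBD_def
  proof (intro conjI ballI impI)
    show "B \<subseteq> Y" "card B \<in> K" if "B \<in> (`) f ` A" for B using that sub f(2) size' by blast+
  qed (fact Y pair')+
  then show ?thesis by (rule that)
qed

subsection \<open>Recursive constructions\<close>

text \<open>Wilson's construction, with \<open>cell x\<close> the set of copies of \<open>x\<close>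
  and its size the weight. Points \<open>z\<close> and \<open>z'\<close> of different new groups
  determine the old points \<open>x\<close> and \<open>y\<close> below them, these determine the
  block \<open>B\<close>, and the ingredient on \<open>B\<close> has exactly one block through
  \<open>z\<close> and \<open>z'\<close>. Weight 0 is allowed, hence the removal of empty cells and
  groups.\<close>

lemma GDD_fundamental_construction:
  assumes gdd: "is_GDD L X G A"
    and fin: "\<And>x. x \<in> X \<Longrightarrow> finite (cell x)"
    and disj: "\<And>x y z. x \<in> X \<Longrightarrow> y \<in> X \<Longrightarrow> z \<in> cell x \<Longrightarrow> z \<in> cell y \<Longrightarrow> x = y"
    and ing: "\<And>B. B \<in> A \<Longrightarrow> is_GDD K (\<Union>x\<in>B. cell x) (cell ` B - {{}}) (D B)"
  shows "is_GDD K (\<Union>x\<in>X. cell x) ((\<lambda>g. \<Union>x\<in>g. cell x) ` G - {{}}) (\<Union>B\<in>A. D B)"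
    (is "is_GDD K ?X ?G ?A")
  unfolding is_GDD_iff
proof (intro conjI)
  have fX: "finite X" and part: "partition_on X G" and sub: "\<And>B. B \<in> A \<Longrightarrow> B \<subseteq> X"
    using is_GDD_D[OF gdd] by auto
  have gX: "\<And>g. g \<in> G \<Longrightarrow> g \<subseteq> X" and XG: "X = \<Union>G" using part unfolding partition_on_def by auto
  have DB: "C \<subseteq> (\<Union>x\<in>B. cell x)" "card C \<in> K" if "B \<in> A" "C \<in> D B" for B C
    using is_GDD_D(3,4)[OF ing[OF that(1)] that(2)] .
  show "finite ?X" using fX fin by blast
  show "partition_on ?X ?G"
  proof (rule partition_onI)
    show "\<Union>?G = ?X" unfolding XG by blast
    show "{} \<notin> ?G" by blast
  next
    fix p q assume p: "p \<in> ?G" and q: "q \<in> ?G" and "p \<noteq> q"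
    then obtain g h where gh: "g \<in> G" "h \<in> G" "g \<noteq> h" "p = (\<Union>x\<in>g. cell x)" "q = (\<Union>x\<in>h. cell x)"
      by blast
    have "z \<notin> q" if "z \<in> p" for z
    proof
      assume "z \<in> q"
      with that gh obtain x y where "x \<in> g" "y \<in> h" "z \<in> cell x" "z \<in> cell y" by blast
      then show False using disj gX gh partition_on_unique[OF part gh(1,2)] by blast
    qed
    then show "disjnt p q" unfolding disjnt_iff by blast
  qed
  show "\<forall>C\<in>?A. C \<subseteq> ?X \<and> card C \<in> K \<and> (\<forall>p\<in>?G. \<forall>z\<in>C \<inter> p. \<forall>z'\<in>C \<inter> p. z = z')"
  proof (intro ballI conjI)
    fix C assume "C \<in> ?A"
    then obtain B where B: "B \<in> A" "C \<in> D B" by blast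
    show "C \<subseteq> ?X" "card C \<in> K" using DB[OF B] sub[OF B(1)] by blast+
    fix p z z' assume p: "p \<in> ?G" and z: "z \<in> C \<inter> p" "z' \<in> C \<inter> p"
    then obtain g x x' where g: "g \<in> G" and x: "x \<in> g" "z \<in> cell x" "x' \<in> g" "z' \<in> cell x'" by blast
    obtain y y' where y: "y \<in> B" "z \<in> cell y" "y' \<in> B" "z' \<in> cell y'" using DB(1)[OF B] z by blast
    have "x = y" "x' = y'" using disj x y gX[OF g] sub[OF B(1)] by blast+
    then have "x = x'" using is_GDD_same_group[OF gdd B(1) g] x y by blast
    then show "z = z'"
      using is_GDD_same_group[OF ing[OF B(1)] B(2), of "cell x" z z'] \<open>x = y\<close> x y z by blast
  qed
  show "\<forall>p\<in>?G. \<forall>q\<in>?G. p \<noteq> q \<longrightarrow> (\<forall>z\<in>p. \<forall>z'\<in>q. \<exists>!C. C \<in> ?A \<and> z \<in> C \<and> z' \<in> C)"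
  proof (intro ballI impI)
    fix p q z z' assume "p \<in> ?G" "q \<in> ?G" "p \<noteq> q" "z \<in> p" "z' \<in> q"
    then obtain g h x y where gh: "g \<in> G" "h \<in> G" "g \<noteq> h" and xy: "x \<in> g" "y \<in> h"
      and z: "z \<in> cell x" "z' \<in> cell y" by blast
    have ne: "x \<noteq> y" using partition_on_unique[OF part gh(1,2)] gh xy by blast
    have xyX: "x \<in> X" "y \<in> X" using gX gh xy by auto
    obtain B where B: "B \<in> A" "x \<in> B" "y \<in> B" using is_GDD_pair[OF gdd gh xy] by blast
    have cells: "cell x \<noteq> cell y" using disj[OF xyX] z ne by blast
    have ex1: "\<exists>!C. C \<in> D B \<and> z \<in> C \<and> z' \<in> C"
      by (rule is_GDD_pair[OF ing[OF B(1)] _ _ cells z]) (use B z in auto)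
    then obtain C where C: "C \<in> D B" "z \<in> C" "z' \<in> C" by blast
    show "\<exists>!C. C \<in> ?A \<and> z \<in> C \<and> z' \<in> C"
    proof (rule ex1I[of _ C])
      show "C \<in> ?A \<and> z \<in> C \<and> z' \<in> C" using B C by blast
      fix C' assume C': "C' \<in> ?A \<and> z \<in> C' \<and> z' \<in> C'"
      then obtain B' where B': "B' \<in> A" "C' \<in> D B'" by blast
      obtain a b where ab: "a \<in> B'" "z \<in> cell a" "b \<in> B'" "z' \<in> cell b" using DB(1)[OF B'] C' by blast
      then have "a = x" "b = y" using disj xyX z sub[OF B'(1)] by blast+
      then have "B' = B" using is_GDD_block_unique[OF gdd B'(1) B(1)] ab B ne by blast
      then show "C' = C" using ex1 C C' B' by blast
    qed
  qed
qed

text \<open>The case \<open>S = {}\<close> is needed for \<open>t = 0\<close>, where the large group consists of the new point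
  alone.\<close>

lemma GDD_fill_groups:
  assumes gdd: "is_GDD K X G A" and S: "S \<in> insert {} G" and new: "pt \<notin> X"
    and pbd: "\<And>g. g \<in> G - {S} \<Longrightarrow> is_PBD (card g + 1) K (insert pt g) (P g)"
  shows "is_GDD K (insert pt X) (insert (insert pt S) ((\<lambda>x. {x}) ` (X - S))) (A \<union> (\<Union>g\<in>G - {S}. P g))"
    (is "is_GDD K ?X ?G ?A")
  unfolding is_GDD_iff
proof (intro conjI)
  have fX: "finite X" and part: "partition_on X G" and sub: "\<And>B. B \<in> A \<Longrightarrow> B \<subseteq> X"
    and szA: "\<And>B. B \<in> A \<Longrightarrow> card B \<in> K"
    using is_GDD_D[OF gdd] by auto
  have gX: "\<And>g. g \<in> G \<Longrightarrow> g \<subseteq> X" and XG: "X = \<Union>G" using part unfolding partition_on_def by auto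
  have SX: "S \<subseteq> X" using S gX by blast
  have Sg: "g \<inter> S = {}" if "g \<in> G - {S}" for g
    using S that partition_on_unique[OF part, of g S] by blast
  have P: "C \<subseteq> insert pt g" "card C \<in> K" if "g \<in> G - {S}" "C \<in> P g" for g C
    using pbd[OF that(1)] that(2) unfolding is_PBD_def by auto
  show "finite ?X" using fX by simp
  show "partition_on ?X ?G"
    by (rule partition_onI) (use SX new in \<open>auto simp: disjnt_iff\<close>)
  show "\<forall>C\<in>?A. C \<subseteq> ?X \<and> card C \<in> K \<and> (\<forall>p\<in>?G. \<forall>z\<in>C \<inter> p. \<forall>z'\<in>C \<inter> p. z = z')"
  proof
    fix C assume "C \<in> ?A"
    then consider "C \<in> A" | g where "g \<in> G - {S}" "C \<in> P g" by blast
    then show "C \<subseteq> ?X \<and> card C \<in> K \<and> (\<forall>p\<in>?G. \<forall>z\<in>C \<inter> p. \<forall>z'\<in>C \<inter> p. z = z')"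
    proof cases
      case 1
      have "z = z'" if "z \<in> C \<inter> insert pt S" "z' \<in> C \<inter> insert pt S" for z z'
      proof -
        have "z \<in> S" "z' \<in> S" using that sub[OF 1] new by blast+
        then show ?thesis using S is_GDD_same_group[OF gdd 1] that by blast
      qed
      then show ?thesis using sub[OF 1] szA[OF 1] by blast
    next
      case 2
      then show ?thesis using P[OF 2] Sg[OF 2(1)] gX[of g] by blast
    qed
  qed
  \<comment> \<open>Pairs inside a filled group, possibly with the new point, are covered only by
    the PBD on that group: a block of \<open>A\<close> meets the group at most once and misses
    \<open>pt\<close>.\<close>
  have within: "\<exists>!C. C \<in> ?A \<and> z \<in> C \<and> z' \<in> C"
    if g: "g \<in> G - {S}" and z: "z \<in> g" "z' \<in> insert pt g" "z \<noteq> z'" for g z z'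
  proof -
    have ex1: "\<exists>!C. C \<in> P g \<and> z \<in> C \<and> z' \<in> C"
      using pbd[OF g] z unfolding is_PBD_def by blast
    moreover have "C \<in> P g" if C: "C \<in> ?A" "z \<in> C" "z' \<in> C" for C
    proof -
      have "C \<notin> A"
      proof
        assume A: "C \<in> A"
        then have "z' \<in> g" using sub new z C by blast
        then show False using is_GDD_same_group[OF gdd A, of g z z'] g z C by blast
      qed
      then obtain h where h: "h \<in> G - {S}" "C \<in> P h" using C by blast
      have "z \<in> h" using P(1)[OF h] C z new gX[of g] g by blast
      then have "h = g" using partition_on_unique[OF part, of h g] h g z by blast
      then show ?thesis using h by simp
    qed
    ultimately show ?thesis using g by blast
  qed
  \<comment> \<open>Pairs from different old groups keep their block in \<open>A\<close>, since
    every PBD block stays inside one old group together with \<open>pt\<close>.\<close>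
  have across: "\<exists>!C. C \<in> ?A \<and> z \<in> C \<and> z' \<in> C"
    if gh: "g \<in> G" "h \<in> G" "g \<noteq> h" and z: "z \<in> g" "z' \<in> h" for g h z z'
  proof -
    have ex1: "\<exists>!C. C \<in> A \<and> z \<in> C \<and> z' \<in> C" using is_GDD_pair[OF gdd gh z] .
    moreover have "C \<in> A" if C: "C \<in> ?A" "z \<in> C" "z' \<in> C" for C
    proof (rule ccontr)
      assume "C \<notin> A"
      then obtain k where k: "k \<in> G - {S}" "C \<in> P k" using C by blast
      have "z \<in> k" "z' \<in> k" using P(1)[OF k] C z new gX gh by blast+
      then show False
        using partition_on_unique[OF part, of k g] partition_on_unique[OF part, of k h] k gh z by blast
    qed
    ultimately show ?thesis by blast
  qed
  have main: "\<exists>!C. C \<in> ?A \<and> z \<in> C \<and> z' \<in> C"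
    if z: "z \<in> X - S" "z' \<in> ?X" "z \<noteq> z'" for z z'
  proof -
    obtain g where g: "g \<in> G" "z \<in> g" using z XG by blast
    then have gS: "g \<in> G - {S}" using z by blast
    show ?thesis
    proof (cases "z' \<in> insert pt g")
      case True
      then show ?thesis by (rule within[OF gS g(2) _ z(3)])
    next
      case False
      then obtain h where h: "h \<in> G" "z' \<in> h" using z XG by blast
      then have "g \<noteq> h" using False by blast
      then show ?thesis by (rule across[OF g(1) h(1) _ g(2) h(2)])
    qed
  qed
  show "\<forall>p\<in>?G. \<forall>q\<in>?G. p \<noteq> q \<longrightarrow> (\<forall>z\<in>p. \<forall>z'\<in>q. \<exists>!C. C \<in> ?A \<and> z \<in> C \<and> z' \<in> C)"
  proof (intro ballI impI)
    fix p q z z' assume pq: "p \<in> ?G" "q \<in> ?G" "p \<noteq> q" and z: "z \<in> p" "z' \<in> q"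
    have zX: "z \<in> ?X" "z' \<in> ?X" using pq z SX by blast+
    \<comment> \<open>Only one group of the new partition contains \<open>pt\<close> and
      \<open>S\<close>; of two different groups at least one is a singleton outside
      \<open>S\<close>, and \<open>main\<close> applies up to symmetry.\<close>
    have "p = {z} \<and> z \<in> X - S \<or> q = {z'} \<and> z' \<in> X - S" using pq z by blast
    then show "\<exists>!C. C \<in> ?A \<and> z \<in> C \<and> z' \<in> C"
    proof
      assume a: "p = {z} \<and> z \<in> X - S"
      then have "z \<noteq> z'" using pq z new by auto
      then show ?thesis by (rule main[OF conjunct2[OF a] zX(2)])
    next
      assume a: "q = {z'} \<and> z' \<in> X - S"
      then have "z' \<noteq> z" using pq z new by auto
      from main[OF conjunct2[OF a] zX(1) this] show ?thesis by (simp only: conj_ac)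
    qed
  qed
qed

text \<open>Outside \<open>S\<close> all groups are singletons, so disjoint blocks covering
  \<open>X - S\<close> can be declared groups. A pair inside such a block was covered by that block
  alone, and any other pair from different new groups keeps its block.\<close>

lemma GDD_blocks_to_groups:
  assumes gdd: "is_GDD K X (insert S ((\<lambda>x. {x}) ` (X - S))) A"
    and R: "R \<subseteq> A" "partition_on (X - S) R"
  shows "is_GDD K X (insert S R) (A - R)"
  unfolding is_GDD_iff
proof (intro conjI)
  have fX: "finite X" and part: "partition_on X (insert S ((\<lambda>x. {x}) ` (X - S)))"
    and szA: "\<And>B. B \<in> A \<Longrightarrow> B \<subseteq> X \<and> card B \<in> K"
    using is_GDD_D[OF gdd] by auto
  have S: "S \<subseteq> X" "S \<noteq> {}" using part unfolding partition_on_def by auto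
  have R': "\<Union>R = X - S" "{} \<notin> R" using R(2) unfolding partition_on_def by auto
  show "finite X" by fact
  have "disjnt S (\<Union>R)" using R' unfolding disjnt_def by blast
  then show "partition_on X (insert S R)" using S R(2) by (simp add: partition_on_insert)
  show "\<forall>B\<in>A - R. B \<subseteq> X \<and> card B \<in> K \<and> (\<forall>p\<in>insert S R. \<forall>x\<in>B \<inter> p. \<forall>y\<in>B \<inter> p. x = y)"
  proof (intro ballI conjI)
    fix B assume B: "B \<in> A - R"
    show "B \<subseteq> X" "card B \<in> K" using szA B by auto
    fix p x y assume p: "p \<in> insert S R" and xy: "x \<in> B \<inter> p" "y \<in> B \<inter> p"
    show "x = y"
    proof (cases "p = S")
      case True
      then show ?thesis using is_GDD_same_group[OF gdd, of B S x y] B xy by blast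
    next
      case False
      then show ?thesis using is_GDD_block_unique[OF gdd, of B p x y] B R p xy by blast
    qed
  qed
  show "\<forall>p\<in>insert S R. \<forall>q\<in>insert S R. p \<noteq> q \<longrightarrow>
      (\<forall>x\<in>p. \<forall>y\<in>q. \<exists>!B. B \<in> A - R \<and> x \<in> B \<and> y \<in> B)"
  proof (intro ballI impI)
    fix p q x y assume pq: "p \<in> insert S R" "q \<in> insert S R" "p \<noteq> q" and xy: "x \<in> p" "y \<in> q"
    \<comment> \<open>The group of \<open>x\<close> in the original GDD.\<close>
    let ?g = "\<lambda>x. if x \<in> S then S else {x}"
    have xyX: "x \<in> X" "y \<in> X" using pq xy S R' by blast+
    have pS: "p = S \<longleftrightarrow> x \<in> S" "q = S \<longleftrightarrow> y \<in> S" using pq xy R' by blast+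
    have "x \<noteq> y \<or> x \<in> S"
      using pq xy pS partition_on_unique[OF R(2), of p q x] by blast
    then have ne: "?g x \<noteq> ?g y" using pS pq by auto
    have "\<exists>!B. B \<in> A \<and> x \<in> B \<and> y \<in> B"
      by (rule is_GDD_pair[OF gdd _ _ ne]) (use xyX in auto)
    moreover have "B \<notin> R" if "x \<in> B" "y \<in> B" for B
    proof
      assume B: "B \<in> R"
      then have "x \<notin> S" "y \<notin> S" using that R' by blast+
      then have "p \<in> R" "q \<in> R" using pq pS by blast+
      then show False using partition_on_unique[OF R(2)] B that xy pq by metis
    qed
    ultimately show "\<exists>!B. B \<in> A - R \<and> x \<in> B \<and> y \<in> B" by blast
  qed
qed

section \<open>Weights on the points of the TD with \<open>l + 1\<close> groups\<close>

theorem theorem1: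
  fixes l m u v :: nat and K :: "nat set"
  assumes "l > 0" and "m > 0" and "u > 0" and "v > 0"
    and "u \<le> m"
    and "\<forall>k\<in>K. k \<ge> 2" and "l \<in> K"
    and "TD_exists (l + 1) m"
    and "TD_exists l u"
    and "GDD_exists K (replicate_mset l u + replicate_mset 1 v)"
    and "PBD_exists (m * u + 1) K"
  shows "\<forall>t::nat. t \<le> m - u \<longrightarrow>
    GDD_exists K (replicate_mset (m * u) l + replicate_mset 1 (t * v + 1))"
proof (intro allI impI)
  fix t assume t: "t \<le> m - u"
  have l2: "l \<ge> 2" using assms by blast
  obtain X :: "nat set" and G A where gdd: "is_GDD {l + 1} X G A"
    and type: "group_type G = replicate_mset (l + 1) m"
    using assms(8) unfolding TD_exists_def GDD_exists_def by blast
  have X: "finite X" "partition_on X G" and AX: "\<And>B. B \<in> A \<Longrightarrow> B \<subseteq> X \<and> card B = l + 1"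
    using is_GDD_D[OF gdd] by auto
  have fG: "finite G" using finite_elements[OF X] .
  note cG = group_type_replicate[OF fG type]
  have XG: "X = \<Union>G" using partition_onD1[OF X(2)] .
  obtain H where H: "H \<in> G" using cG(1) by fastforce
  have HX: "H \<subseteq> X" using XG H by blast
  have cH: "card H = m" "finite H" using cG(2)[OF H] finite_subset[OF HX X(1)] by auto
  have meetH: "\<exists>h. B \<inter> H = {h}" if "B \<in> A" for B
    using transversal_block[of G X A B H] gdd cG(1) that H by metis
  have card_diff: "card (B - H) = l" if B: "B \<in> A" for B
  proof -
    obtain h where h: "B \<inter> H = {h}" using meetH[OF B] by blast
    then have "card (B - H) = card B - 1" by (simp add: card_Diff_subset_Int)
    then show ?thesis using AX[OF B] by simp
  qed
  obtain W where W: "W \<subseteq> H" "card W = t" "finite W"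
    using obtain_subset_with_card_n[of t H] t cH by (metis diff_le_self le_trans)
  have "card (H - W) = m - t" using W cH by (simp add: card_Diff_subset)
  then have "card {..<u} \<le> card (H - W)" using t assms(5) by simp
  \<comment> \<open>One point of weight 0 for each layer index \<open>i < u\<close>; the inequality
    \<open>u \<le> m - t\<close> provides enough of them.\<close>
  then obtain c where c: "inj_on c {..<u}" "c ` {..<u} \<subseteq> H - W"
    using card_le_inj[of "{..<u}" "H - W"] cH by auto
  define wt where "wt x = (if x \<in> H then if x \<in> W then v else 0 else u)" for x
  \<comment> \<open>The option type supplies the point at infinity: \<open>Some (x, j)\<close> is
    the \<open>j\<close>-th copy of \<open>x\<close>, and \<open>None\<close> lies in no
    cell.\<close>
  define cell :: "nat \<Rightarrow> (nat \<times> nat) option set" where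
    "cell x = (\<lambda>j. Some (x, j)) ` {..<wt x}" for x
  define layer :: "nat \<Rightarrow> nat set \<Rightarrow> (nat \<times> nat) option set" where
    "layer i B = (\<lambda>x. Some (x, i)) ` (B - H)" for i B
  have card_cell: "card (cell x) = wt x" "finite (cell x)" for x
    unfolding cell_def by (auto simp: card_image inj_on_def)
  have cell_eq: "x = y" if "z \<in> cell x" "z \<in> cell y" for x y z
    using that unfolding cell_def by auto
  have inj_cell: "inj_on cell S" if "\<And>x. x \<in> S \<Longrightarrow> wt x > 0" for S
  proof (rule inj_onI)
    fix x y assume "x \<in> S" "cell x = cell y"
    then show "x = y" using cell_eq[of "Some (x, 0)" x y] that[of x] unfolding cell_def by auto
  qed
  have cell_part: "partition_on (\<Union>x\<in>S. cell x) (cell ` S - {{}})" for S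
    by (rule partition_onI) (auto simp: disjnt_iff dest: cell_eq)
  have cell_empty: "cell x = {} \<longleftrightarrow> wt x = 0" for x unfolding cell_def by auto
  have cells_type: "group_type (cell ` S) = replicate_mset (card S) u" if "S \<inter> H = {}" for S
  proof -
    have wt: "wt x = u" if "x \<in> S" for x using that \<open>S \<inter> H = {}\<close> unfolding wt_def by auto
    have "card (cell ` S) = card S" using inj_cell[of S] wt assms(3) by (intro card_image) auto
    then show ?thesis using group_type_constant[of "cell ` S" u] card_cell wt by fastforce
  qed

  \<comment> \<open>Ingredient designs on the inflated blocks\<close>
  have "\<exists>D. is_GDD K (\<Union>x\<in>B. cell x) (cell ` B - {{}}) D \<and> (\<forall>i<u. c i \<in> B \<longrightarrow> layer i B \<in> D)"
    if B: "B \<in> A" for B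
  proof -
    have fB: "finite B" using AX[OF B] by (simp add: card_ge_0_finite)
    obtain h where h: "B \<inter> H = {h}" using meetH[OF B] by blast
    have fin: "finite (\<Union>x\<in>B. cell x)" using fB card_cell by blast
    have type0: "group_type (cell ` (B - H)) = replicate_mset l u"
      using cells_type[of "B - H"] card_diff[OF B] by auto
    have wtpos: "wt x > 0" if "x \<in> B - H" for x using that assms(3) unfolding wt_def by auto
    show ?thesis
    proof (cases "h \<in> W")
      case True
      \<comment> \<open>The cells over \<open>B\<close> have sizes \<open>u\<close>
        (\<open>l\<close> times) and \<open>v\<close> (once), so the given \<open>K\<close>-GDD
        fits. No \<open>c i\<close> lies on \<open>B\<close>, so nothing is asked of the
        layers.\<close>
      have wth: "wt h = v" using True h unfolding wt_def by auto
      have wtB: "wt x > 0" if "x \<in> B" for x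
        using that wtpos[of x] wth h assms(4) by (cases "x = h") auto
      have eq: "cell ` B - {{}} = insert (cell h) (cell ` (B - H))"
        using wtB cell_empty h by fastforce
      have "cell h \<notin> cell ` (B - H)"
      proof
        assume "cell h \<in> cell ` (B - H)"
        then obtain x where x: "x \<in> B - H" "cell h = cell x" by blast
        then have "h = x" using inj_onD[OF inj_cell[OF wtB] x(2)] h by blast
        then show False using x h by blast
      qed
      then have "group_type (cell ` B - {{}}) = replicate_mset l u + replicate_mset 1 v"
        unfolding eq using type0 fB card_cell wth by (subst group_type_insert) auto
      with assms(10) have "GDD_exists K (group_type (cell ` B - {{}}))" by simp
      then obtain D where D: "is_GDD K (\<Union>x\<in>B. cell x) (cell ` B - {{}}) D"
        using GDD_on_partition[OF _ fin cell_part] by blast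
      moreover have "c i \<notin> B" if "i < u" for i
      proof
        assume "c i \<in> B"
        moreover have "c i \<in> H - W" using c(2) that by blast
        ultimately have "c i \<in> B \<inter> H" "c i \<notin> W" by auto
        then show False using True unfolding h by simp
      qed
      ultimately show ?thesis by blast
    next
      case False
      \<comment> \<open>The cell of \<open>h\<close> vanishes and leaves \<open>l\<close> cells of
        size \<open>u\<close>, the type of the smaller TD.\<close>
      have wth: "wt h = 0" using False h unfolding wt_def by auto
      have eq: "cell ` B - {{}} = cell ` (B - H)"
      proof
        have "cell x \<in> cell ` (B - H)" if "x \<in> B" "cell x \<noteq> {}" for x
          using that h wth cell_empty[of x] by (cases "x = h") auto
        then show "cell ` B - {{}} \<subseteq> cell ` (B - H)" by blast
        show "cell ` (B - H) \<subseteq> cell ` B - {{}}" using wtpos cell_empty by fastforce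
      qed
      \<comment> \<open>The index with \<open>c i = h\<close>, if there is one. Otherwise no layer
        is required to be a block, and the default 0 only has to be below \<open>u\<close>.\<close>
      define i where "i = (if h \<in> c ` {..<u} then inv_into {..<u} c h else 0)"
      have iu: "i < u" unfolding i_def using assms(3) inv_into_into[of h c "{..<u}"] by auto
      have ic: "j = i" if "j < u" "c j \<in> B" for j
      proof -
        have "c j \<in> B \<inter> H" using that c(2) by blast
        then have "c j = h" unfolding h by simp
        then show ?thesis unfolding i_def using that inv_into_f_f[OF c(1), of j] by auto
      qed
      \<comment> \<open>The transversal must be a function of the cell, so the point
        \<open>x\<close> is read off from an arbitrary element of \<open>cell x\<close>; the value
        is then the copy of \<open>x\<close> in layer \<open>i\<close>.\<close>
      define b where "b q = Some (fst (the (SOME z. z \<in> q)), i)" for q :: "(nat \<times> nat) option set"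
      have bc: "b (cell x) = Some (x, i)" if "x \<in> B - H" for x
      proof -
        have "(SOME z. z \<in> cell x) \<in> cell x"
          using wtpos[OF that] cell_empty[of x] by (metis some_in_eq less_nat_zero_code)
        then show ?thesis unfolding b_def cell_def by auto
      qed
      have b: "b q \<in> q" if q: "q \<in> cell ` B - {{}}" for q
      proof -
        obtain x where x: "x \<in> B - H" "q = cell x" using q unfolding eq by blast
        then have "wt x = u" unfolding wt_def by auto
        then show ?thesis using x bc iu unfolding cell_def by auto
      qed
      have type1: "group_type (cell ` B - {{}}) = replicate_mset l u" using type0 unfolding eq .
      obtain D where D: "is_GDD {l} (\<Union>x\<in>B. cell x) (cell ` B - {{}}) D" "b ` (cell ` B - {{}}) \<in> D"
        using TD_on_partition[OF assms(9) fin cell_part l2 type1 b] by blast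
      have "b ` (cell ` B - {{}}) = layer i B"
        unfolding eq layer_def image_image using bc by (intro image_cong) auto
      then have "\<forall>j<u. c j \<in> B \<longrightarrow> layer j B \<in> D" using D(2) ic by metis
      moreover have "is_GDD K (\<Union>x\<in>B. cell x) (cell ` B - {{}}) D"
        using is_GDD_mono[OF D(1), of K] assms(7) by simp
      ultimately show ?thesis by blast
    qed
  qed
  then obtain D where D: "\<And>B. B \<in> A \<Longrightarrow> is_GDD K (\<Union>x\<in>B. cell x) (cell ` B - {{}}) (D B)"
    and layerD: "\<And>B i. B \<in> A \<Longrightarrow> i < u \<Longrightarrow> c i \<in> B \<Longrightarrow> layer i B \<in> D B" by metis

  \<comment> \<open>Inflation of the TD and filling of its groups\<close>
  let ?inflate = "\<lambda>g. \<Union>x\<in>g. cell x"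
  have gdd1: "is_GDD K (?inflate X) (?inflate ` G - {{}}) (\<Union>B\<in>A. D B)"
    by (rule GDD_fundamental_construction[OF gdd _ _ D]) (use card_cell cell_eq in auto)
  \<comment> \<open>For \<open>t = 0\<close> the inflated \<open>H\<close> is empty and thus not a
    group, whence the alternative \<open>{}\<close>.\<close>
  have SG: "?inflate H \<in> insert {} (?inflate ` G - {{}})" using H by blast
  have "\<exists>P. is_PBD (card q + 1) K (insert None q) P" if q: "q \<in> ?inflate ` G - {{}} - {?inflate H}" for q
  proof -
    obtain g where g: "g \<in> G" "q = ?inflate g" "g \<noteq> H" using q by blast
    have fg: "finite g" "card g = m" using g(1) XG X(1) cG(2) by (auto intro: finite_subset)
    have "x \<notin> H" if "x \<in> g" for x using that g H partition_on_unique[OF X(2)] by blast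
    then have "card (cell x) = u" if "x \<in> g" for x using that card_cell unfolding wt_def by simp
    moreover have "card q = (\<Sum>x\<in>g. card (cell x))" unfolding g(2)
      by (rule card_UN_disjoint) (use fg card_cell cell_eq in auto)
    ultimately have cq: "card q = m * u" using fg by simp
    have fq: "finite q" using fg card_cell unfolding g(2) by blast
    have "None \<notin> q" unfolding g(2) cell_def by auto
    then have "card (insert None q) = m * u + 1" using fq cq by simp
    then show ?thesis using PBD_on_set[OF assms(11), of "insert None q"] fq unfolding cq by auto
  qed
  then obtain P where P: "\<And>q. q \<in> ?inflate ` G - {{}} - {?inflate H} \<Longrightarrow>
      is_PBD (card q + 1) K (insert None q) (P q)" by metis
  have None: "None \<notin> ?inflate g" for g unfolding cell_def by auto
  let ?X = "insert None (?inflate X)" and ?S = "insert None (?inflate H)"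
  let ?A = "(\<Union>B\<in>A. D B) \<union> (\<Union>q\<in>?inflate ` G - {{}} - {?inflate H}. P q)"
  have diff: "?X - ?S = ?inflate X - ?inflate H" using None[of X] by blast
  have gdd2: "is_GDD K ?X (insert ?S ((\<lambda>x. {x}) ` (?X - ?S))) ?A"
    unfolding diff by (rule GDD_fill_groups[OF gdd1 SG None P])

  \<comment> \<open>The layers as a parallel class outside the large group\<close>
  define R where "R = {layer i B | i B. i < u \<and> B \<in> A \<and> c i \<in> B}"
  have "R \<subseteq> (\<Union>B\<in>A. D B)" unfolding R_def using layerD by fast
  then have RA: "R \<subseteq> ?A" by (rule le_supI1)
  have XS: "?X - ?S = (\<lambda>(x, i). Some (x, i)) ` ((X - H) \<times> {..<u})"
    unfolding diff
  proof (intro set_eqI iffI)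
    fix z assume "z \<in> ?inflate X - ?inflate H"
    then obtain x where "x \<in> X - H" "z \<in> cell x" by blast
    then show "z \<in> (\<lambda>(x, i). Some (x, i)) ` ((X - H) \<times> {..<u})"
      unfolding cell_def wt_def by auto
  next
    fix z assume "z \<in> (\<lambda>(x, i). Some (x, i)) ` ((X - H) \<times> {..<u})"
    then obtain x i where "x \<in> X - H" "i < u" "z = Some (x, i)" by auto
    then have "x \<in> X - H" "z \<in> cell x" unfolding cell_def wt_def by auto
    then show "z \<in> ?inflate X - ?inflate H" using cell_eq by blast
  qed
  have cR: "card r = l \<and> r \<noteq> {}" if "r \<in> R" for r
  proof -
    obtain i B where iB: "B \<in> A" "r = layer i B" using \<open>r \<in> R\<close> unfolding R_def by blast
    have "card r = l" using card_diff[OF iB(1)] unfolding iB(2) layer_def by (simp add: card_image inj_on_def)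
    then show ?thesis using assms(1) by auto
  qed
  have partR: "partition_on (?X - ?S) R"
  proof (rule partition_onI)
    show "{} \<notin> R" using cR by blast
    show "\<Union>R = ?X - ?S"
    proof (intro set_eqI iffI)
      fix z assume "z \<in> \<Union>R"
      then obtain i B x where "i < u" "B \<in> A" "x \<in> B - H" "z = Some (x, i)"
        unfolding R_def layer_def by blast
      then show "z \<in> ?X - ?S" unfolding XS using AX[of B] by auto
    next
      fix z assume "z \<in> ?X - ?S"
      then obtain x i where xi: "x \<in> X - H" "i < u" "z = Some (x, i)" unfolding XS by auto
      obtain g where g: "g \<in> G" "x \<in> g" using xi XG by blast
      \<comment> \<open>The point \<open>Some (x, i)\<close> is covered by the layer of the TD block
        through \<open>x\<close> and \<open>c i\<close>, which exists since these points lie in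
        different groups.\<close>
      have "c i \<in> H" using c(2) xi(2) by blast
      moreover have "g \<noteq> H" using g xi by blast
      ultimately obtain B where "B \<in> A" "x \<in> B" "c i \<in> B"
        using is_GDD_pair[OF gdd g(1) H _ g(2)] by blast
      then have "layer i B \<in> R" "z \<in> layer i B" unfolding R_def layer_def using xi by auto
      then show "z \<in> \<Union>R" by blast
    qed
  next
    fix r s assume "r \<in> R" "s \<in> R" "r \<noteq> s"
    then obtain i B j C where r: "B \<in> A" "i < u" "c i \<in> B" "r = layer i B"
      and s: "C \<in> A" "j < u" "c j \<in> C" "s = layer j C" unfolding R_def by blast
    have "z \<notin> s" if "z \<in> r" for z
    proof
      assume "z \<in> s"
      with that r(4) s(4) obtain x where x: "x \<in> B" "x \<in> C" "x \<notin> H" "i = j"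
        unfolding layer_def by blast
      \<comment> \<open>Layers with a common point have the same index \<open>i\<close>, so both
        blocks contain the distinct points \<open>x\<close> and \<open>c i\<close> and must be
        equal.\<close>
      have "c i \<noteq> x" using c(2) r(2) x(3) by blast
      then have "B = C" using is_GDD_block_unique[OF gdd r(1) s(1), of x "c i"] x r(3) s(3) by blast
      then show False using x \<open>r \<noteq> s\<close> r(4) s(4) by simp
    qed
    then show "disjnt r s" unfolding disjnt_iff by blast
  qed

  \<comment> \<open>Counting the layers and the large group\<close>
  have cardX: "card X = (l + 1) * m"
  proof -
    have "card X = (\<Sum>g\<in>G. card g)" unfolding XG
      by (rule card_Union_disjoint)
        (use X XG fG in \<open>auto simp: partition_on_def disjoint_def pairwise_def disjnt_def intro: finite_subset\<close>)
    then show ?thesis using cG by simp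
  qed
  have "card (?X - ?S) = card ((X - H) \<times> {..<u})"
    unfolding XS by (rule card_image) (auto simp: inj_on_def)
  also have "\<dots> = l * (m * u)"
    using cardX cH HX X(1) by (simp add: card_cartesian_product card_Diff_subset)
  finally have cXS: "card (?X - ?S) = l * (m * u)" .
  have finXS: "finite (?X - ?S)" unfolding XS using X(1) by simp
  have fR: "finite R" using finite_elements[OF finXS partR] .
  have "card (\<Union>R) = (\<Sum>r\<in>R. card r)"
    by (rule card_Union_disjoint)
      (use partition_onD2[OF partR] cR assms(1) in
        \<open>auto simp: disjoint_def pairwise_def disjnt_def intro!: card_ge_0_finite\<close>)
  \<comment> \<open>The layers have size \<open>l\<close> and partition \<open>l * (m * u)\<close>
    points; cancelling \<open>l > 0\<close> gives their number.\<close>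
  then have "card R * l = l * (m * u)" using cXS partition_onD1[OF partR] cR by simp
  then have cardR: "card R = m * u" using assms(1) by simp
  have typeR: "group_type R = replicate_mset (m * u) l"
    using group_type_constant[of R l] cR cardR by simp
  have "card (?inflate H) = t * v"
  proof -
    have "card (?inflate H) = (\<Sum>x\<in>H. card (cell x))"
      by (rule card_UN_disjoint) (use cH card_cell cell_eq in auto)
    also have "\<dots> = (\<Sum>x\<in>H. if x \<in> W then v else 0)"
      using card_cell unfolding wt_def by (intro sum.cong) auto
    also have "\<dots> = (\<Sum>x\<in>W. v)" using W(1) cH(2) by (simp add: sum.If_cases Int_absorb1)
    finally show ?thesis using W(2) by simp
  qed
  moreover have "finite (?inflate H)" using cH card_cell by blast
  ultimately have cardS: "card ?S = t * v + 1" using None by simp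
  have "?S \<notin> R" using partition_onD1[OF partR] by blast
  then have "group_type (insert ?S R) = replicate_mset (m * u) l + replicate_mset 1 (t * v + 1)"
    using group_type_insert[OF fR] typeR cardS by simp
  then show "GDD_exists K (replicate_mset (m * u) l + replicate_mset 1 (t * v + 1))"
    using GDD_existsI[OF GDD_blocks_to_groups[OF gdd2 RA partR]] by simp
qed

end
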